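(* Let $k$ be a commutative ring with unit, $A$ an associative unital $k$-algebra, $M$ an $A$-bimodule (symmetric over $k$), and $f: A\times A\to M$ a Hochschild 2-cocycle of $A$ with coefficients in $M$. Let $B=A+M$ be the $k$-algebra corresponding to the $k$-allowable singular extension of $A$ by $M$ defined by $f$. Then: 1) An element $(e,t)\in B$ (with $e\in A$, $t\in M$) is an idempotent in $B$ if and only if $e$ is an idempotent in $A$ and $$et+te+f(e,e)=t. \qquad ( * )$$ 2) If $e$ is an idempotent of $A$ and $x\in M$, then equation $( * )$ (in the unknown $t\in M$) has the solution $$t=(1-2e)f(e,e)+ex-xe.$$ 3) For an idempotent $e$ of $A$, equation $( * )$ has a unique solution $t\in M$ if and only if $ex=xe$ for all $x\in M$.
   Context: Bimodules $M$ over $A$ are symmetric over $k$: $cm=mc$ for $c\in k$, $m\in M$. A Hochschild 2-cocycle of $A$ with coefficients in $M$ (relative to $k$) is a $k$-bilinear map $f:A\times A\to M$ such that $af(b,c)-f(ab,c)+f(a,bc)-f(a,b)c=0$ for all $a,b,c\in A$. The $k$-algebra $B$ corresponding to the $k$-allowable singular extension of $A$ by $M$ defined by $f$ is the $k$-module direct sum $B=A+M$ (pairs $(a,m)$) with multiplication $(a,m)(a',m')=(aa',\,am'+ma'+f(a,a'))$; it is an associative algebra with unit $(1,-f(1,1))$. *)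

theory Defs
  imports "HOL-Algebra.Module"
begin

text \<open>The library locale \<open>algebra\<close> requires the algebra to be commutative; here it need not be.\<close>

locale assoc_algebra = A: ring A + module k A
  for k :: "('k, 'w) ring_scheme" (structure) and A :: "('k, 'a, 'x) module_scheme" (structure) +
  assumes smult_mult_left:
      "\<lbrakk>c \<in> carrier k; a \<in> carrier A; b \<in> carrier A\<rbrakk> \<Longrightarrow>
      (c \<odot>\<^bsub>A\<^esub> a) \<otimes>\<^bsub>A\<^esub> b = c \<odot>\<^bsub>A\<^esub> (a \<otimes>\<^bsub>A\<^esub> b)"
    and smult_mult_right:
      "\<lbrakk>c \<in> carrier k; a \<in> carrier A; b \<in> carrier A\<rbrakk> \<Longrightarrow>
      a \<otimes>\<^bsub>A\<^esub> (c \<odot>\<^bsub>A\<^esub> b) = c \<odot>\<^bsub>A\<^esub> (a \<otimes>\<^bsub>A\<^esub> b)"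

text \<open>As for the library record \<open>module\<close>, the inherited fields \<open>mult\<close> and \<open>one\<close> play no role.\<close>

record ('a, 'k, 'm) bimodule = "('k, 'm) module" +
  lact :: "'a \<Rightarrow> 'm \<Rightarrow> 'm" (infixr "\<triangleright>\<index>" 70)
  ract :: "'m \<Rightarrow> 'a \<Rightarrow> 'm" (infixl "\<triangleleft>\<index>" 70)

text \<open>
  The two axioms \<open>central\<close> say that both the left and the right action of \<open>k\<close> on \<open>M\<close> through
  \<open>c \<mapsto> c \<cdot> 1 \<in> A\<close> agree with the \<open>k\<close>-module structure of \<open>M\<close>; this is the symmetry \<open>cm = mc\<close>.
\<close>

locale symmetric_bimodule = assoc_algebra k A + M: module k M
  for k :: "('k, 'w) ring_scheme" (structure) and A :: "('k, 'a, 'x) module_scheme" (structure)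
    and M :: "('a, 'k, 'm, 'y) bimodule_scheme" (structure) +
  assumes lact_closed [simp, intro]:
      "\<lbrakk>a \<in> carrier A; m \<in> carrier M\<rbrakk> \<Longrightarrow> a \<triangleright>\<^bsub>M\<^esub> m \<in> carrier M"
    and ract_closed [simp, intro]:
      "\<lbrakk>a \<in> carrier A; m \<in> carrier M\<rbrakk> \<Longrightarrow> m \<triangleleft>\<^bsub>M\<^esub> a \<in> carrier M"
    and lact_add_left:
      "\<lbrakk>a \<in> carrier A; b \<in> carrier A; m \<in> carrier M\<rbrakk> \<Longrightarrow>
      (a \<oplus>\<^bsub>A\<^esub> b) \<triangleright>\<^bsub>M\<^esub> m = (a \<triangleright>\<^bsub>M\<^esub> m) \<oplus>\<^bsub>M\<^esub> (b \<triangleright>\<^bsub>M\<^esub> m)"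
    and lact_add_right:
      "\<lbrakk>a \<in> carrier A; m \<in> carrier M; n \<in> carrier M\<rbrakk> \<Longrightarrow>
      a \<triangleright>\<^bsub>M\<^esub> (m \<oplus>\<^bsub>M\<^esub> n) = (a \<triangleright>\<^bsub>M\<^esub> m) \<oplus>\<^bsub>M\<^esub> (a \<triangleright>\<^bsub>M\<^esub> n)"
    and ract_add_left:
      "\<lbrakk>a \<in> carrier A; m \<in> carrier M; n \<in> carrier M\<rbrakk> \<Longrightarrow>
      (m \<oplus>\<^bsub>M\<^esub> n) \<triangleleft>\<^bsub>M\<^esub> a = (m \<triangleleft>\<^bsub>M\<^esub> a) \<oplus>\<^bsub>M\<^esub> (n \<triangleleft>\<^bsub>M\<^esub> a)"
    and ract_add_right:
      "\<lbrakk>a \<in> carrier A; b \<in> carrier A; m \<in> carrier M\<rbrakk> \<Longrightarrow>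
      m \<triangleleft>\<^bsub>M\<^esub> (a \<oplus>\<^bsub>A\<^esub> b) = (m \<triangleleft>\<^bsub>M\<^esub> a) \<oplus>\<^bsub>M\<^esub> (m \<triangleleft>\<^bsub>M\<^esub> b)"
    and lact_one [simp]: "m \<in> carrier M \<Longrightarrow> \<one>\<^bsub>A\<^esub> \<triangleright>\<^bsub>M\<^esub> m = m"
    and ract_one [simp]: "m \<in> carrier M \<Longrightarrow> m \<triangleleft>\<^bsub>M\<^esub> \<one>\<^bsub>A\<^esub> = m"
    and lact_assoc:
      "\<lbrakk>a \<in> carrier A; b \<in> carrier A; m \<in> carrier M\<rbrakk> \<Longrightarrow>
      (a \<otimes>\<^bsub>A\<^esub> b) \<triangleright>\<^bsub>M\<^esub> m = a \<triangleright>\<^bsub>M\<^esub> (b \<triangleright>\<^bsub>M\<^esub> m)"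
    and ract_assoc:
      "\<lbrakk>a \<in> carrier A; b \<in> carrier A; m \<in> carrier M\<rbrakk> \<Longrightarrow>
      m \<triangleleft>\<^bsub>M\<^esub> (a \<otimes>\<^bsub>A\<^esub> b) = (m \<triangleleft>\<^bsub>M\<^esub> a) \<triangleleft>\<^bsub>M\<^esub> b"
    and lact_ract_assoc:
      "\<lbrakk>a \<in> carrier A; b \<in> carrier A; m \<in> carrier M\<rbrakk> \<Longrightarrow>
      (a \<triangleright>\<^bsub>M\<^esub> m) \<triangleleft>\<^bsub>M\<^esub> b = a \<triangleright>\<^bsub>M\<^esub> (m \<triangleleft>\<^bsub>M\<^esub> b)"
    and lact_central:
      "\<lbrakk>c \<in> carrier k; m \<in> carrier M\<rbrakk> \<Longrightarrow> (c \<odot>\<^bsub>A\<^esub> \<one>\<^bsub>A\<^esub>) \<triangleright>\<^bsub>M\<^esub> m = c \<odot>\<^bsub>M\<^esub> m"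
    and ract_central:
      "\<lbrakk>c \<in> carrier k; m \<in> carrier M\<rbrakk> \<Longrightarrow> m \<triangleleft>\<^bsub>M\<^esub> (c \<odot>\<^bsub>A\<^esub> \<one>\<^bsub>A\<^esub>) = c \<odot>\<^bsub>M\<^esub> m"

locale hochschild_2cocycle = symmetric_bimodule k A M
  for k :: "('k, 'w) ring_scheme" (structure) and A :: "('k, 'a, 'x) module_scheme" (structure)
    and M :: "('a, 'k, 'm, 'y) bimodule_scheme" (structure) +
  fixes f :: "'a \<Rightarrow> 'a \<Rightarrow> 'm"
  assumes cocycle_closed [simp, intro]:
      "\<lbrakk>a \<in> carrier A; b \<in> carrier A\<rbrakk> \<Longrightarrow> f a b \<in> carrier M"
    and cocycle_add_left:
      "\<lbrakk>a \<in> carrier A; a' \<in> carrier A; b \<in> carrier A\<rbrakk> \<Longrightarrow>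
      f (a \<oplus>\<^bsub>A\<^esub> a') b = f a b \<oplus>\<^bsub>M\<^esub> f a' b"
    and cocycle_add_right:
      "\<lbrakk>a \<in> carrier A; b \<in> carrier A; b' \<in> carrier A\<rbrakk> \<Longrightarrow>
      f a (b \<oplus>\<^bsub>A\<^esub> b') = f a b \<oplus>\<^bsub>M\<^esub> f a b'"
    and cocycle_smult_left:
      "\<lbrakk>c \<in> carrier k; a \<in> carrier A; b \<in> carrier A\<rbrakk> \<Longrightarrow>
      f (c \<odot>\<^bsub>A\<^esub> a) b = c \<odot>\<^bsub>M\<^esub> f a b"
    and cocycle_smult_right:
      "\<lbrakk>c \<in> carrier k; a \<in> carrier A; b \<in> carrier A\<rbrakk> \<Longrightarrow>
      f a (c \<odot>\<^bsub>A\<^esub> b) = c \<odot>\<^bsub>M\<^esub> f a b"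
    and cocycle:
      "\<lbrakk>a \<in> carrier A; a' \<in> carrier A; a'' \<in> carrier A\<rbrakk> \<Longrightarrow>
      (a \<triangleright>\<^bsub>M\<^esub> f a' a'') \<ominus>\<^bsub>M\<^esub> f (a \<otimes>\<^bsub>A\<^esub> a') a'' \<oplus>\<^bsub>M\<^esub> f a (a' \<otimes>\<^bsub>A\<^esub> a'') \<ominus>\<^bsub>M\<^esub> (f a a' \<triangleleft>\<^bsub>M\<^esub> a'')
        = \<zero>\<^bsub>M\<^esub>"

definition singular_extension ::
    "('k, 'a, 'x) module_scheme \<Rightarrow> ('a, 'k, 'm, 'y) bimodule_scheme \<Rightarrow>
     ('a \<Rightarrow> 'a \<Rightarrow> 'm) \<Rightarrow> ('k, 'a \<times> 'm) module" where
  "singular_extension A M f =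
    \<lparr>carrier = carrier A \<times> carrier M,
     mult = (\<lambda>(a, m) (a', m').
       (a \<otimes>\<^bsub>A\<^esub> a', (a \<triangleright>\<^bsub>M\<^esub> m') \<oplus>\<^bsub>M\<^esub> (m \<triangleleft>\<^bsub>M\<^esub> a') \<oplus>\<^bsub>M\<^esub> f a a')),
     one = (\<one>\<^bsub>A\<^esub>, \<ominus>\<^bsub>M\<^esub> f \<one>\<^bsub>A\<^esub> \<one>\<^bsub>A\<^esub>),
     zero = (\<zero>\<^bsub>A\<^esub>, \<zero>\<^bsub>M\<^esub>),
     add = (\<lambda>(a, m) (a', m'). (a \<oplus>\<^bsub>A\<^esub> a', m \<oplus>\<^bsub>M\<^esub> m')),
     smult = (\<lambda>c (a, m). (c \<odot>\<^bsub>A\<^esub> a, c \<odot>\<^bsub>M\<^esub> m))\<rparr>"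

context hochschild_2cocycle
begin

lemma smult_one_mult:
  assumes "c \<in> carrier k" "a \<in> carrier A"
  shows "c \<odot>\<^bsub>A\<^esub> a = (c \<odot>\<^bsub>A\<^esub> \<one>\<^bsub>A\<^esub>) \<otimes>\<^bsub>A\<^esub> a" "c \<odot>\<^bsub>A\<^esub> a = a \<otimes>\<^bsub>A\<^esub> (c \<odot>\<^bsub>A\<^esub> \<one>\<^bsub>A\<^esub>)"
  using assms by (simp_all add: smult_mult_left smult_mult_right)

lemma smult_lact:
  assumes "c \<in> carrier k" "a \<in> carrier A" "m \<in> carrier M"
  shows "(c \<odot>\<^bsub>A\<^esub> a) \<triangleright>\<^bsub>M\<^esub> m = c \<odot>\<^bsub>M\<^esub> (a \<triangleright>\<^bsub>M\<^esub> m)" "a \<triangleright>\<^bsub>M\<^esub> (c \<odot>\<^bsub>M\<^esub> m) = c \<odot>\<^bsub>M\<^esub> (a \<triangleright>\<^bsub>M\<^esub> m)"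
proof -
  show 1: "(c \<odot>\<^bsub>A\<^esub> a) \<triangleright>\<^bsub>M\<^esub> m = c \<odot>\<^bsub>M\<^esub> (a \<triangleright>\<^bsub>M\<^esub> m)"
    using assms by (subst smult_one_mult(1)) (simp_all add: lact_assoc lact_central)
  have "a \<triangleright>\<^bsub>M\<^esub> (c \<odot>\<^bsub>M\<^esub> m) = (a \<otimes>\<^bsub>A\<^esub> (c \<odot>\<^bsub>A\<^esub> \<one>\<^bsub>A\<^esub>)) \<triangleright>\<^bsub>M\<^esub> m"
    using assms by (subst lact_assoc) (simp_all add: lact_central)
  then show "a \<triangleright>\<^bsub>M\<^esub> (c \<odot>\<^bsub>M\<^esub> m) = c \<odot>\<^bsub>M\<^esub> (a \<triangleright>\<^bsub>M\<^esub> m)"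
    using 1 assms smult_one_mult(2) by metis
qed

lemma smult_ract:
  assumes "c \<in> carrier k" "a \<in> carrier A" "m \<in> carrier M"
  shows "m \<triangleleft>\<^bsub>M\<^esub> (c \<odot>\<^bsub>A\<^esub> a) = c \<odot>\<^bsub>M\<^esub> (m \<triangleleft>\<^bsub>M\<^esub> a)" "(c \<odot>\<^bsub>M\<^esub> m) \<triangleleft>\<^bsub>M\<^esub> a = c \<odot>\<^bsub>M\<^esub> (m \<triangleleft>\<^bsub>M\<^esub> a)"
proof -
  show 1: "m \<triangleleft>\<^bsub>M\<^esub> (c \<odot>\<^bsub>A\<^esub> a) = c \<odot>\<^bsub>M\<^esub> (m \<triangleleft>\<^bsub>M\<^esub> a)"
    using assms by (subst smult_one_mult(2)) (simp_all add: ract_assoc ract_central)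
  have "(c \<odot>\<^bsub>M\<^esub> m) \<triangleleft>\<^bsub>M\<^esub> a = m \<triangleleft>\<^bsub>M\<^esub> ((c \<odot>\<^bsub>A\<^esub> \<one>\<^bsub>A\<^esub>) \<otimes>\<^bsub>A\<^esub> a)"
    using assms by (subst ract_assoc) (simp_all add: ract_central)
  then show "(c \<odot>\<^bsub>M\<^esub> m) \<triangleleft>\<^bsub>M\<^esub> a = c \<odot>\<^bsub>M\<^esub> (m \<triangleleft>\<^bsub>M\<^esub> a)"
    using 1 assms smult_one_mult(1) by metis
qed

lemma cocycle_sum:
  assumes "a \<in> carrier A" "b \<in> carrier A" "c \<in> carrier A"
  shows "f (a \<otimes>\<^bsub>A\<^esub> b) c \<oplus>\<^bsub>M\<^esub> (f a b \<triangleleft>\<^bsub>M\<^esub> c) = (a \<triangleright>\<^bsub>M\<^esub> f b c) \<oplus>\<^bsub>M\<^esub> f a (b \<otimes>\<^bsub>A\<^esub> c)"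
proof -
  have *: "y \<oplus>\<^bsub>M\<^esub> w = x \<oplus>\<^bsub>M\<^esub> z" if "x \<ominus>\<^bsub>M\<^esub> y \<oplus>\<^bsub>M\<^esub> z \<ominus>\<^bsub>M\<^esub> w = \<zero>\<^bsub>M\<^esub>"
    "x \<in> carrier M" "y \<in> carrier M" "z \<in> carrier M" "w \<in> carrier M" for x y z w
  proof -
    have "y \<oplus>\<^bsub>M\<^esub> w = (x \<ominus>\<^bsub>M\<^esub> y \<oplus>\<^bsub>M\<^esub> z \<ominus>\<^bsub>M\<^esub> w) \<oplus>\<^bsub>M\<^esub> (y \<oplus>\<^bsub>M\<^esub> w)" using that by simp
    also have "\<dots> = x \<oplus>\<^bsub>M\<^esub> z" using that(2-)
      by (simp add: a_minus_def M.M.a_ac M.M.r_neg M.M.r_neg1 M.M.r_neg2)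
    finally show ?thesis .
  qed
  show ?thesis using assms by (intro * cocycle) auto
qed

lemma lact_zero [simp]: "m \<in> carrier M \<Longrightarrow> \<zero>\<^bsub>A\<^esub> \<triangleright>\<^bsub>M\<^esub> m = \<zero>\<^bsub>M\<^esub>"
  using lact_central[of "\<zero>\<^bsub>k\<^esub>" m] by simp

lemma ract_zero [simp]: "m \<in> carrier M \<Longrightarrow> m \<triangleleft>\<^bsub>M\<^esub> \<zero>\<^bsub>A\<^esub> = \<zero>\<^bsub>M\<^esub>"
  using ract_central[of "\<zero>\<^bsub>k\<^esub>" m] by simp

lemma lact_minus [simp]:
  assumes "a \<in> carrier A" "m \<in> carrier M"
  shows "a \<triangleright>\<^bsub>M\<^esub> (\<ominus>\<^bsub>M\<^esub> m) = \<ominus>\<^bsub>M\<^esub> (a \<triangleright>\<^bsub>M\<^esub> m)"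
  using smult_lact(2)[of "\<ominus>\<^bsub>k\<^esub> \<one>\<^bsub>k\<^esub>" a m] assms by (simp add: M.smult_l_minus)

lemma ract_minus [simp]:
  assumes "a \<in> carrier A" "m \<in> carrier M"
  shows "(\<ominus>\<^bsub>M\<^esub> m) \<triangleleft>\<^bsub>M\<^esub> a = \<ominus>\<^bsub>M\<^esub> (m \<triangleleft>\<^bsub>M\<^esub> a)"
  using smult_ract(2)[of "\<ominus>\<^bsub>k\<^esub> \<one>\<^bsub>k\<^esub>" a m] assms by (simp add: M.smult_l_minus)

lemma cocycle_one:
  assumes "a \<in> carrier A"
  shows "f \<one>\<^bsub>A\<^esub> a = f \<one>\<^bsub>A\<^esub> \<one>\<^bsub>A\<^esub> \<triangleleft>\<^bsub>M\<^esub> a" "f a \<one>\<^bsub>A\<^esub> = a \<triangleright>\<^bsub>M\<^esub> f \<one>\<^bsub>A\<^esub> \<one>\<^bsub>A\<^esub>"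
  using cocycle_sum[of "\<one>\<^bsub>A\<^esub>" "\<one>\<^bsub>A\<^esub>" a] cocycle_sum[of a "\<one>\<^bsub>A\<^esub>" "\<one>\<^bsub>A\<^esub>"] assms by simp_all

lemma singular_extension_algebra: "assoc_algebra k (singular_extension A M f)"
proof -
  let ?B = "singular_extension A M f"
  note defs = singular_extension_def
  note distr = lact_add_left lact_add_right ract_add_left ract_add_right
    lact_assoc ract_assoc lact_ract_assoc
  have add: "abelian_group ?B"
  proof (rule abelian_groupI)
    fix x assume "x \<in> carrier ?B"
    then show "\<exists>y\<in>carrier ?B. y \<oplus>\<^bsub>?B\<^esub> x = \<zero>\<^bsub>?B\<^esub>"
      by (auto simp: defs intro!: bexI[of _ "(\<ominus>\<^bsub>A\<^esub> fst x, \<ominus>\<^bsub>M\<^esub> snd x)"] A.l_neg M.M.l_neg)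
  qed (auto simp: defs A.a_ac M.M.a_ac)
  have assoc: "(x \<otimes>\<^bsub>?B\<^esub> y) \<otimes>\<^bsub>?B\<^esub> z = x \<otimes>\<^bsub>?B\<^esub> (y \<otimes>\<^bsub>?B\<^esub> z)"
    if "x \<in> carrier ?B" "y \<in> carrier ?B" "z \<in> carrier ?B" for x y z
  proof -
    obtain a p b q c r where [simp]: "x = (a, p)" "y = (b, q)" "z = (c, r)"
      by (metis surj_pair)
    have in_carrier [simp]: "a \<in> carrier A" "b \<in> carrier A" "c \<in> carrier A"
      "p \<in> carrier M" "q \<in> carrier M" "r \<in> carrier M"
      using that by (auto simp: defs)
    have "((a \<otimes>\<^bsub>A\<^esub> b) \<triangleright>\<^bsub>M\<^esub> r) \<oplus>\<^bsub>M\<^esub> (((a \<triangleright>\<^bsub>M\<^esub> q) \<oplus>\<^bsub>M\<^esub> (p \<triangleleft>\<^bsub>M\<^esub> b) \<oplus>\<^bsub>M\<^esub> f a b) \<triangleleft>\<^bsub>M\<^esub> c) \<oplus>\<^bsub>M\<^esub> f (a \<otimes>\<^bsub>A\<^esub> b) c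
      = (a \<triangleright>\<^bsub>M\<^esub> (b \<triangleright>\<^bsub>M\<^esub> r)) \<oplus>\<^bsub>M\<^esub> (a \<triangleright>\<^bsub>M\<^esub> (q \<triangleleft>\<^bsub>M\<^esub> c)) \<oplus>\<^bsub>M\<^esub> ((p \<triangleleft>\<^bsub>M\<^esub> b) \<triangleleft>\<^bsub>M\<^esub> c)
        \<oplus>\<^bsub>M\<^esub> (f (a \<otimes>\<^bsub>A\<^esub> b) c \<oplus>\<^bsub>M\<^esub> (f a b \<triangleleft>\<^bsub>M\<^esub> c))"
      by (simp add: distr M.M.a_ac)
    also have "\<dots> = (a \<triangleright>\<^bsub>M\<^esub> ((b \<triangleright>\<^bsub>M\<^esub> r) \<oplus>\<^bsub>M\<^esub> (q \<triangleleft>\<^bsub>M\<^esub> c) \<oplus>\<^bsub>M\<^esub> f b c)) \<oplus>\<^bsub>M\<^esub> (p \<triangleleft>\<^bsub>M\<^esub> (b \<otimes>\<^bsub>A\<^esub> c)) \<oplus>\<^bsub>M\<^esub> f a (b \<otimes>\<^bsub>A\<^esub> c)"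
      unfolding cocycle_sum[OF in_carrier(1-3)] by (simp add: distr M.M.a_ac)
    finally show ?thesis by (simp add: defs A.m_assoc)
  qed
  have mon: "monoid ?B"
  proof (rule monoidI)
    fix x y z assume "x \<in> carrier ?B" "y \<in> carrier ?B" "z \<in> carrier ?B"
    then show "(x \<otimes>\<^bsub>?B\<^esub> y) \<otimes>\<^bsub>?B\<^esub> z = x \<otimes>\<^bsub>?B\<^esub> (y \<otimes>\<^bsub>?B\<^esub> z)" by (rule assoc)
  next
    fix x assume "x \<in> carrier ?B"
    then obtain a m where [simp]: "x = (a, m)" "a \<in> carrier A" "m \<in> carrier M"
      by (auto simp: defs)
    show "\<one>\<^bsub>?B\<^esub> \<otimes>\<^bsub>?B\<^esub> x = x"
      by (simp add: defs cocycle_one(1)[of a] M.M.a_assoc M.M.l_neg)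
    show "x \<otimes>\<^bsub>?B\<^esub> \<one>\<^bsub>?B\<^esub> = x"
      by (simp add: defs cocycle_one(2)[of a] M.M.a_comm[of _ m] M.M.a_assoc M.M.l_neg)
  qed (auto simp: defs)
  have ring: "ring ?B"
    by (rule ringI[OF add mon])
      (auto simp: defs distr A.l_distr A.r_distr cocycle_add_left cocycle_add_right M.M.a_ac)
  have mod: "module k ?B"
    by (rule moduleI[OF R.is_cring add])
      (auto simp: defs smult_l_distr smult_r_distr smult_assoc1
        M.smult_l_distr M.smult_r_distr M.smult_assoc1)
  show ?thesis
    by (intro assoc_algebra.intro assoc_algebra_axioms.intro mod ring)
      (auto simp: defs smult_mult_left smult_mult_right smult_lact smult_ract
        cocycle_smult_left cocycle_smult_right M.smult_r_distr)
qed

end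

definition idempotent_elem :: "('a, 'x) ring_scheme \<Rightarrow> 'a \<Rightarrow> bool" where
  "idempotent_elem R e \<longleftrightarrow> e \<in> carrier R \<and> e \<otimes>\<^bsub>R\<^esub> e = e"

end

theory Submission
  imports Defs
begin

text \<open>
  Taking all three arguments of the cocycle identity equal to an idempotent \<open>e\<close> shows that
  \<open>e\<close> commutes with \<open>f e e\<close>, which makes part 2 a direct computation. Comparing the solutions given
  by \<open>x\<close> and by \<open>0\<close> shows that uniqueness forces \<open>e x = x e\<close>. Conversely, if \<open>e\<close> is central then
  \<open>2 e t + f e e = t\<close>; multiplying by \<open>e\<close> gives \<open>e t = - e (f e e)\<close>, which determines \<open>t\<close>.
\<close>

context hochschild_2cocycle
begin

text \<open>Expands the coefficient 1 - 2e of the solution formula into terms of \<open>M\<close>;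
  \<open>[(2::nat)]\<close> denotes a natural multiple in the additive group of \<open>A\<close>.
  Idempotence of \<open>e\<close> plays no part here.\<close>

lemma lact_one_minus_double:
  assumes "e \<in> carrier A" "m \<in> carrier M"
  shows "(\<one>\<^bsub>A\<^esub> \<ominus>\<^bsub>A\<^esub> [(2::nat)] \<cdot>\<^bsub>A\<^esub> e) \<triangleright>\<^bsub>M\<^esub> m = m \<oplus>\<^bsub>M\<^esub> (\<ominus>\<^bsub>M\<^esub> (e \<triangleright>\<^bsub>M\<^esub> m) \<oplus>\<^bsub>M\<^esub> \<ominus>\<^bsub>M\<^esub> (e \<triangleright>\<^bsub>M\<^esub> m))"
proof -
  \<comment> \<open>Additivity in the algebra argument makes (-a)m + am equal to 0m = 0, so (-a)m is
    the additive inverse of am.\<close>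
  have neg: "(\<ominus>\<^bsub>A\<^esub> a) \<triangleright>\<^bsub>M\<^esub> m = \<ominus>\<^bsub>M\<^esub> (a \<triangleright>\<^bsub>M\<^esub> m)" if "a \<in> carrier A" for a
    using M.M.minus_equality[of "(\<ominus>\<^bsub>A\<^esub> a) \<triangleright>\<^bsub>M\<^esub> m" "a \<triangleright>\<^bsub>M\<^esub> m"]
      lact_add_left[of "\<ominus>\<^bsub>A\<^esub> a" a m] that assms by (simp add: A.l_neg)
  have "[(2::nat)] \<cdot>\<^bsub>A\<^esub> e = e \<oplus>\<^bsub>A\<^esub> e"
    using assms by (simp add: numeral_2_eq_2)
  then show ?thesis
    using assms by (simp add: a_minus_def lact_add_left neg M.M.minus_add)
qed

lemma lact_cocycle_idem:
  assumes "idempotent_elem A e"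
  shows "f e e \<triangleleft>\<^bsub>M\<^esub> e = e \<triangleright>\<^bsub>M\<^esub> f e e"
proof -
  have e: "e \<in> carrier A" "e \<otimes>\<^bsub>A\<^esub> e = e"
    using assms by (simp_all add: idempotent_elem_def)
  \<comment> \<open>Since ee = e, both f(ee,e) and f(e,ee) collapse to \<open>f e e\<close>, and
    they stand on opposite sides of \<open>cocycle_sum\<close>, ready to be cancelled.\<close>
  then have "(f e e \<triangleleft>\<^bsub>M\<^esub> e) \<oplus>\<^bsub>M\<^esub> f e e = (e \<triangleright>\<^bsub>M\<^esub> f e e) \<oplus>\<^bsub>M\<^esub> f e e"
    using cocycle_sum[of e e e] by (simp add: M.M.a_comm)
  then show ?thesis
    using e by (simp add: M.M.add.right_cancel)
qed

text \<open>Write F = f(e,e) and p = eF, so that t = F - 2p + ex - xe. Multiplying by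
  \<open>e\<close> on the left gives -p + ex - exe, on the right exe - p - xe. The mixed term exe
  cancels in the sum, and adding F restores t.\<close>

lemma idem_equation_solution:
  assumes idem: "idempotent_elem A e" and x: "x \<in> carrier M"
  defines "t \<equiv> ((\<one>\<^bsub>A\<^esub> \<ominus>\<^bsub>A\<^esub> [(2::nat)] \<cdot>\<^bsub>A\<^esub> e) \<triangleright>\<^bsub>M\<^esub> f e e) \<oplus>\<^bsub>M\<^esub> (e \<triangleright>\<^bsub>M\<^esub> x) \<ominus>\<^bsub>M\<^esub> (x \<triangleleft>\<^bsub>M\<^esub> e)"
  shows "t \<in> carrier M" "(e \<triangleright>\<^bsub>M\<^esub> t) \<oplus>\<^bsub>M\<^esub> (t \<triangleleft>\<^bsub>M\<^esub> e) \<oplus>\<^bsub>M\<^esub> f e e = t"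
proof -
  have e [simp]: "e \<in> carrier A" "e \<otimes>\<^bsub>A\<^esub> e = e"
    using idem by (simp_all add: idempotent_elem_def)
  note [simp] = x
  have ee: "e \<triangleright>\<^bsub>M\<^esub> (e \<triangleright>\<^bsub>M\<^esub> m) = e \<triangleright>\<^bsub>M\<^esub> m" "(m \<triangleleft>\<^bsub>M\<^esub> e) \<triangleleft>\<^bsub>M\<^esub> e = m \<triangleleft>\<^bsub>M\<^esub> e"
    if "m \<in> carrier M" for m
    using lact_assoc[of e e m] ract_assoc[of e e m] that by simp_all
  \<comment> \<open>Left and right multiplication by \<open>e\<close> send F, p, q and r to p, q, r
    or s, so the verification becomes arithmetic in an abelian group.\<close>
  define F p q r s where "F = f e e" and "p = e \<triangleright>\<^bsub>M\<^esub> f e e" and "q = e \<triangleright>\<^bsub>M\<^esub> x"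
    and "r = x \<triangleleft>\<^bsub>M\<^esub> e" and "s = e \<triangleright>\<^bsub>M\<^esub> (x \<triangleleft>\<^bsub>M\<^esub> e)"
  note abbr = F_def p_def q_def r_def s_def
  have [simp]: "F \<in> carrier M" "p \<in> carrier M" "q \<in> carrier M" "r \<in> carrier M" "s \<in> carrier M"
    by (simp_all add: abbr)
  have t: "t = F \<oplus>\<^bsub>M\<^esub> (\<ominus>\<^bsub>M\<^esub> p \<oplus>\<^bsub>M\<^esub> \<ominus>\<^bsub>M\<^esub> p) \<oplus>\<^bsub>M\<^esub> q \<oplus>\<^bsub>M\<^esub> \<ominus>\<^bsub>M\<^esub> r"
    unfolding t_def abbr by (subst lact_one_minus_double) (simp_all add: a_minus_def)
  show "t \<in> carrier M"
    by (simp add: t)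
  have lF: "e \<triangleright>\<^bsub>M\<^esub> F = p" "e \<triangleright>\<^bsub>M\<^esub> p = p" "e \<triangleright>\<^bsub>M\<^esub> q = q" "e \<triangleright>\<^bsub>M\<^esub> r = s"
    by (simp_all add: abbr ee)
  \<comment> \<open>Commutation of \<open>e\<close> with F enters here: Fe = eF = p, and hence pe =
    e(Fe) = e(eF) = p.\<close>
  have rF: "F \<triangleleft>\<^bsub>M\<^esub> e = p" "p \<triangleleft>\<^bsub>M\<^esub> e = p" "q \<triangleleft>\<^bsub>M\<^esub> e = s" "r \<triangleleft>\<^bsub>M\<^esub> e = r"
    by (simp_all add: abbr ee lact_cocycle_idem[OF idem] lact_ract_assoc)
  have lt: "e \<triangleright>\<^bsub>M\<^esub> t = \<ominus>\<^bsub>M\<^esub> p \<oplus>\<^bsub>M\<^esub> q \<oplus>\<^bsub>M\<^esub> \<ominus>\<^bsub>M\<^esub> s"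
    by (simp add: t lact_add_right lF M.M.a_assoc M.M.r_neg2)
  have rt: "t \<triangleleft>\<^bsub>M\<^esub> e = s \<oplus>\<^bsub>M\<^esub> (\<ominus>\<^bsub>M\<^esub> p \<oplus>\<^bsub>M\<^esub> \<ominus>\<^bsub>M\<^esub> r)"
    by (simp add: t ract_add_left rF M.M.a_assoc M.M.r_neg2 M.M.a_lcomm[of s])
  show "(e \<triangleright>\<^bsub>M\<^esub> t) \<oplus>\<^bsub>M\<^esub> (t \<triangleleft>\<^bsub>M\<^esub> e) \<oplus>\<^bsub>M\<^esub> f e e = t"
    unfolding lt rt F_def[symmetric]
    by (simp add: t M.M.a_assoc M.M.r_neg1) (simp add: M.M.a_ac)
qed

text \<open>The right-hand side is (1 - 2e)f(e,e) and does not involve \<open>t\<close>, so any two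
  solutions that commute with \<open>e\<close> coincide.\<close>

lemma central_idem_equation_solution:
  assumes idem: "idempotent_elem A e" and t: "t \<in> carrier M"
    and central: "t \<triangleleft>\<^bsub>M\<^esub> e = e \<triangleright>\<^bsub>M\<^esub> t"
    and sol: "(e \<triangleright>\<^bsub>M\<^esub> t) \<oplus>\<^bsub>M\<^esub> (t \<triangleleft>\<^bsub>M\<^esub> e) \<oplus>\<^bsub>M\<^esub> f e e = t"
  shows "t = \<ominus>\<^bsub>M\<^esub> (e \<triangleright>\<^bsub>M\<^esub> f e e) \<oplus>\<^bsub>M\<^esub> \<ominus>\<^bsub>M\<^esub> (e \<triangleright>\<^bsub>M\<^esub> f e e) \<oplus>\<^bsub>M\<^esub> f e e"
proof -
  have e [simp]: "e \<in> carrier A" "e \<otimes>\<^bsub>A\<^esub> e = e"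
    using idem by (simp_all add: idempotent_elem_def)
  note [simp] = t
  have ee: "e \<triangleright>\<^bsub>M\<^esub> (e \<triangleright>\<^bsub>M\<^esub> t) = e \<triangleright>\<^bsub>M\<^esub> t"
    using lact_assoc[of e e t] by simp
  have "e \<triangleright>\<^bsub>M\<^esub> ((e \<triangleright>\<^bsub>M\<^esub> t) \<oplus>\<^bsub>M\<^esub> (e \<triangleright>\<^bsub>M\<^esub> t) \<oplus>\<^bsub>M\<^esub> f e e) = e \<triangleright>\<^bsub>M\<^esub> t"
    using sol central by simp
  then have "(e \<triangleright>\<^bsub>M\<^esub> t) \<oplus>\<^bsub>M\<^esub> ((e \<triangleright>\<^bsub>M\<^esub> t) \<oplus>\<^bsub>M\<^esub> (e \<triangleright>\<^bsub>M\<^esub> f e e)) = e \<triangleright>\<^bsub>M\<^esub> t"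
    by (simp add: lact_add_right ee M.M.a_assoc)
  \<comment> \<open>Multiplying the equation by \<open>e\<close> left a spare copy of et on the
    left-hand side; cancelling et once determines et.\<close>
  then have "(e \<triangleright>\<^bsub>M\<^esub> t) \<oplus>\<^bsub>M\<^esub> (e \<triangleright>\<^bsub>M\<^esub> f e e) = \<zero>\<^bsub>M\<^esub>"
    by (subst (asm) M.M.add.l_cancel_one) simp_all
  then have "e \<triangleright>\<^bsub>M\<^esub> t = \<ominus>\<^bsub>M\<^esub> (e \<triangleright>\<^bsub>M\<^esub> f e e)"
    by (intro M.M.minus_equality[symmetric]) simp_all
  then show ?thesis
    using sol central by simp
qed

text \<open>Solutions always exist, so only uniqueness is at stake. The explicit family has the free
  parameter \<open>x\<close>, and ex - xe measures its distance from the member at 0.\<close>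

lemma idem_equation_unique_iff:
  assumes idem: "idempotent_elem A e"
  shows "(\<exists>!t. t \<in> carrier M \<and> (e \<triangleright>\<^bsub>M\<^esub> t) \<oplus>\<^bsub>M\<^esub> (t \<triangleleft>\<^bsub>M\<^esub> e) \<oplus>\<^bsub>M\<^esub> f e e = t) \<longleftrightarrow>
    (\<forall>x\<in>carrier M. e \<triangleright>\<^bsub>M\<^esub> x = x \<triangleleft>\<^bsub>M\<^esub> e)"
    (is "(\<exists>!t. ?sol t) \<longleftrightarrow> ?central")
proof
  have e [simp]: "e \<in> carrier A"
    using idem by (simp add: idempotent_elem_def)
  let ?u = "(\<one>\<^bsub>A\<^esub> \<ominus>\<^bsub>A\<^esub> [(2::nat)] \<cdot>\<^bsub>A\<^esub> e) \<triangleright>\<^bsub>M\<^esub> f e e"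
  have u: "?u \<in> carrier M"
    by simp
  have sol: "?sol (?u \<oplus>\<^bsub>M\<^esub> (e \<triangleright>\<^bsub>M\<^esub> x) \<ominus>\<^bsub>M\<^esub> (x \<triangleleft>\<^bsub>M\<^esub> e))" if "x \<in> carrier M" for x
    using idem_equation_solution[OF idem that] by blast
  show ?central if unique: "\<exists>!t. ?sol t"
  proof
    fix x assume x: "x \<in> carrier M"
    \<comment> \<open>Here zero lies in \<open>M\<close>, not in \<open>A\<close>: it is rewritten
      as a multiple by the zero scalar of \<open>k\<close>, which moves out of both actions.\<close>
    have zero: "e \<triangleright>\<^bsub>M\<^esub> \<zero>\<^bsub>M\<^esub> = \<zero>\<^bsub>M\<^esub>" "\<zero>\<^bsub>M\<^esub> \<triangleleft>\<^bsub>M\<^esub> e = \<zero>\<^bsub>M\<^esub>"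
      using smult_lact(2)[of "\<zero>\<^bsub>k\<^esub>" e "\<zero>\<^bsub>M\<^esub>"] smult_ract(2)[of "\<zero>\<^bsub>k\<^esub>" e "\<zero>\<^bsub>M\<^esub>"] by simp_all
    have "?u \<oplus>\<^bsub>M\<^esub> (e \<triangleright>\<^bsub>M\<^esub> x) \<ominus>\<^bsub>M\<^esub> (x \<triangleleft>\<^bsub>M\<^esub> e)
        = ?u \<oplus>\<^bsub>M\<^esub> (e \<triangleright>\<^bsub>M\<^esub> \<zero>\<^bsub>M\<^esub>) \<ominus>\<^bsub>M\<^esub> (\<zero>\<^bsub>M\<^esub> \<triangleleft>\<^bsub>M\<^esub> e)"
      using unique sol[OF x] sol[OF M.M.zero_closed] by blast
    then have "?u \<oplus>\<^bsub>M\<^esub> ((e \<triangleright>\<^bsub>M\<^esub> x) \<ominus>\<^bsub>M\<^esub> (x \<triangleleft>\<^bsub>M\<^esub> e)) = ?u"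
      using x u by (simp add: zero a_minus_def M.M.a_assoc)
    then have "(e \<triangleright>\<^bsub>M\<^esub> x) \<ominus>\<^bsub>M\<^esub> (x \<triangleleft>\<^bsub>M\<^esub> e) = \<zero>\<^bsub>M\<^esub>"
      using x u by (subst (asm) M.M.add.l_cancel_one) simp_all
    then show "e \<triangleright>\<^bsub>M\<^esub> x = x \<triangleleft>\<^bsub>M\<^esub> e"
      using x M.M.minus_equality[of "e \<triangleright>\<^bsub>M\<^esub> x" "\<ominus>\<^bsub>M\<^esub> (x \<triangleleft>\<^bsub>M\<^esub> e)"]
      by (simp add: a_minus_def)
  qed
  show "\<exists>!t. ?sol t" if ?central
    \<comment> \<open>The parameter value 0 supplies existence; uniqueness holds because all
      solutions equal the same closed expression.\<close>
    using sol[OF M.M.zero_closed] central_idem_equation_solution[OF idem] that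
    by (intro ex_ex1I) (blast, metis)
qed

text \<open>Squaring (e,t) and comparing coordinates gives ee = e in \<open>A\<close> and the
  displayed equation in \<open>M\<close>.\<close>

lemma idempotent_singular_extension_iff:
  assumes "(e, t) \<in> carrier (singular_extension A M f)"
  shows "idempotent_elem (singular_extension A M f) (e, t) \<longleftrightarrow>
    idempotent_elem A e \<and> (e \<triangleright>\<^bsub>M\<^esub> t) \<oplus>\<^bsub>M\<^esub> (t \<triangleleft>\<^bsub>M\<^esub> e) \<oplus>\<^bsub>M\<^esub> f e e = t"
  using assms by (auto simp: idempotent_elem_def singular_extension_def)

end

theorem theorem1:
  fixes k :: "('k, 'w) ring_scheme"
    and A :: "('k, 'a, 'x) module_scheme"
    and M :: "('a, 'k, 'm, 'y) bimodule_scheme"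
    and f :: "'a \<Rightarrow> 'a \<Rightarrow> 'm"
  assumes "hochschild_2cocycle k A M f"
  shows "(\<forall>e t. (e, t) \<in> carrier (singular_extension A M f) \<longrightarrow>
           (idempotent_elem (singular_extension A M f) (e, t) \<longleftrightarrow>
             idempotent_elem A e \<and> (e \<triangleright>\<^bsub>M\<^esub> t) \<oplus>\<^bsub>M\<^esub> (t \<triangleleft>\<^bsub>M\<^esub> e) \<oplus>\<^bsub>M\<^esub> f e e = t))
       \<and> (\<forall>e x. idempotent_elem A e \<longrightarrow> x \<in> carrier M \<longrightarrow>
           (let t = ((\<one>\<^bsub>A\<^esub> \<ominus>\<^bsub>A\<^esub> [(2::nat)] \<cdot>\<^bsub>A\<^esub> e) \<triangleright>\<^bsub>M\<^esub> f e e) \<oplus>\<^bsub>M\<^esub> (e \<triangleright>\<^bsub>M\<^esub> x) \<ominus>\<^bsub>M\<^esub> (x \<triangleleft>\<^bsub>M\<^esub> e)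
            in t \<in> carrier M \<and> (e \<triangleright>\<^bsub>M\<^esub> t) \<oplus>\<^bsub>M\<^esub> (t \<triangleleft>\<^bsub>M\<^esub> e) \<oplus>\<^bsub>M\<^esub> f e e = t))
       \<and> (\<forall>e. idempotent_elem A e \<longrightarrow>
           ((\<exists>!t. t \<in> carrier M \<and> (e \<triangleright>\<^bsub>M\<^esub> t) \<oplus>\<^bsub>M\<^esub> (t \<triangleleft>\<^bsub>M\<^esub> e) \<oplus>\<^bsub>M\<^esub> f e e = t) \<longleftrightarrow>
            (\<forall>x\<in>carrier M. e \<triangleright>\<^bsub>M\<^esub> x = x \<triangleleft>\<^bsub>M\<^esub> e)))"
proof -
  interpret hochschild_2cocycle k A M f
    by (fact assms)
  show ?thesis
    unfolding Let_def
    using idempotent_singular_extension_iff idem_equation_solution idem_equation_unique_iff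
    by blast
qed

end
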